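(* Let $\mathcal H$ be a complex Hilbert space and let $\mathbf A=(A_1,\dots,A_m)$ be an $m$-tuple of bounded self-adjoint operators on $\mathcal H$. If $\dim\mathcal H\ge \left\lfloor\frac{m+1}{2}\right\rfloor (m+1)^2$, then the joint numerical range $\Lambda_1(\mathbf A)=\{(\langle A_1x,x\rangle,\dots,\langle A_mx,x\rangle): x\in\mathcal H,\ \|x\|=1\}$ is star-shaped.
   Context: A set $S\subseteq\mathbb R^m$ is star-shaped if there exists $\mathbf c\in S$ such that for every $\mathbf b\in S$ the segment joining $\mathbf c$ and $\mathbf b$ lies in $S$. $\lfloor x\rfloor$ denotes the integer part of $x$. *)

theory Defs
  imports "HOL-Analysis.Analysis"
begin

text \<open>HOL-Analysis has no complex inner product spaces, so a complex Hilbert space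
  is given explicitly: an abelian group 'h with a complex scalar multiplication sc
  and a complex inner product ip (linear in the first, conjugate-linear in the
  second argument), complete w.r.t. the induced norm.\<close>

definition hnorm :: "('h \<Rightarrow> 'h \<Rightarrow> complex) \<Rightarrow> 'h \<Rightarrow> real" where
  "hnorm ip x = sqrt (Re (ip x x))"

definition complex_hilbert_space ::
  "(complex \<Rightarrow> 'h::ab_group_add \<Rightarrow> 'h) \<Rightarrow> ('h \<Rightarrow> 'h \<Rightarrow> complex) \<Rightarrow> bool" where
  "complex_hilbert_space sc ip \<longleftrightarrow>
     vector_space sc \<and>
     (\<forall>x y. ip x y = cnj (ip y x)) \<and>
     (\<forall>x y z. ip (x + y) z = ip x z + ip y z) \<and>
     (\<forall>c x y. ip (sc c x) y = c * ip x y) \<and>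
     (\<forall>x. Re (ip x x) \<ge> 0) \<and>
     (\<forall>x. ip x x = 0 \<longrightarrow> x = 0) \<and>
     (\<forall>X :: nat \<Rightarrow> 'h.
        (\<forall>e>0. \<exists>N. \<forall>n\<ge>N. \<forall>k\<ge>N. hnorm ip (X n - X k) < e) \<longrightarrow>
        (\<exists>L. (\<lambda>n. hnorm ip (X n - L)) \<longlonglongrightarrow> 0))"

text \<open>(Complex) dimension at least N: there are N linearly independent vectors.
  This covers infinite-dimensional spaces as well.\<close>
definition dim_at_least :: "(complex \<Rightarrow> 'h::ab_group_add \<Rightarrow> 'h) \<Rightarrow> nat \<Rightarrow> bool" where
  "dim_at_least sc N \<longleftrightarrow> (\<exists>B. finite B \<and> card B = N \<and> module.independent sc B)"

definition bounded_selfadjoint ::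
  "(complex \<Rightarrow> 'h::ab_group_add \<Rightarrow> 'h) \<Rightarrow> ('h \<Rightarrow> 'h \<Rightarrow> complex) \<Rightarrow> ('h \<Rightarrow> 'h) \<Rightarrow> bool" where
  "bounded_selfadjoint sc ip T \<longleftrightarrow>
     Vector_Spaces.linear sc sc T \<and>
     (\<exists>K. \<forall>x. hnorm ip (T x) \<le> K * hnorm ip x) \<and>
     (\<forall>x y. ip (T x) y = ip x (T y))"

text \<open>Joint numerical range in R^m; for self-adjoint operators the values
  ip (A k x) x are real, so we take real parts.\<close>
definition joint_numerical_range ::
  "('h \<Rightarrow> 'h \<Rightarrow> complex) \<Rightarrow> ('m::finite \<Rightarrow> 'h \<Rightarrow> 'h) \<Rightarrow> (real ^ 'm) set" where
  "joint_numerical_range ip A =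
     {(\<chi> k. Re (ip (A k x) x)) | x. hnorm ip x = 1}"

end

theory Submission
  imports Defs
begin

text \<open>Let \<open>m\<close> be the number of operators. Viewing the Hilbert space as a real space, greedily
  choose nonzero vectors that are mutually orthogonal for the norm form and all \<open>m\<close> forms of the
  \<open>A k\<close>; each costs at most \<open>m + 1\<close> real dimensions. A Tverberg partition of their values groups
  them into \<open>m\<close> blocks, giving a real \<open>m\<close>-dimensional subspace \<open>V\<close> on which every unit vector has
  the same joint value \<open>c\<close>, the star center. If a unit vector \<open>x\<close> has value \<open>a\<close>, the dimension of
  \<open>V\<close> allows a nonzero \<open>u\<close> in \<open>V\<close> whose cross term with \<open>x\<close> for the forms shifted by \<open>c\<close> is parallel
  to \<open>a - c\<close>; the normalised vectors \<open>x + r u\<close> then have values filling the half-open segment from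
  \<open>a\<close> to \<open>c\<close>.\<close>

section \<open>Linear algebra: underdetermined homogeneous systems\<close>

text \<open>Gaussian elimination: each equation either vanishes identically or has a pivot, whose
  removal costs one unknown, so an unknown is left over at the end.\<close>

lemma homogeneous_system_nontrivial:
  fixes a :: "'i \<Rightarrow> 'j \<Rightarrow> 'a::field"
  assumes "finite I" "finite J" "card I < card J"
  shows "\<exists>c. (\<exists>j\<in>J. c j \<noteq> 0) \<and> (\<forall>i\<in>I. (\<Sum>j\<in>J. c j * a i j) = 0)"
  using assms
proof (induction I arbitrary: J a rule: finite_induct)
  case empty
  then obtain j where "j \<in> J" by fastforce
  then show ?case by (intro exI[of _ "\<lambda>_. 1"]) auto
next
  case (insert i I)
  show ?case
  proof (cases "\<forall>j\<in>J. a i j = 0")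
    case True
    have "card I < card J" using insert by simp
    with insert.IH[of J a] insert.prems show ?thesis using True by auto
  next
    case False
    then obtain k where k: "k \<in> J" "a i k \<noteq> 0" by blast
    define J' where "J' = J - {k}"
    have J: "J = insert k J'" "k \<notin> J'" "finite J'" using k insert.prems by (auto simp: J'_def)
    have "card I < card J'" using insert J by simp
    then obtain c where c: "\<exists>j\<in>J'. c j \<noteq> 0"
        "\<And>l. l \<in> I \<Longrightarrow> (\<Sum>j\<in>J'. c j * (a l j - a l k / a i k * a i j)) = 0"
      using insert.IH[of J' "\<lambda>l j. a l j - a l k / a i k * a i j"] J by blast
    \<comment> \<open>The value at the pivot \<open>k\<close> is forced by equation
      \<open>i\<close>; substituting it turns each remaining equation into its eliminated
      form.\<close>
    define d where "d = c(k := - (\<Sum>j\<in>J'. c j * a i j) / a i k)"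
    have sum_d: "(\<Sum>j\<in>J. d j * a l j) = (\<Sum>j\<in>J'. c j * (a l j - a l k / a i k * a i j))" for l
    proof -
      have "(\<Sum>j\<in>J'. d j * a l j) = (\<Sum>j\<in>J'. c j * a l j)"
        using J by (intro sum.cong) (auto simp: d_def)
      then show ?thesis
        using J by (simp add: d_def algebra_simps sum_subtractf sum_distrib_left sum_divide_distrib)
    qed
    have "(\<Sum>j\<in>J. d j * a l j) = 0" if "l \<in> insert i I" for l
      using that c(2) k unfolding sum_d by auto
    moreover have "\<exists>j\<in>J. d j \<noteq> 0" using c(1) J by (auto simp: d_def)
    ultimately show ?thesis by blast
  qed
qed


section \<open>Convex geometry: colorful Caratheodory and Tverberg partitions\<close>

text \<open>Since \<open>f\<close> may repeat values, all weight of a point goes to one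
  representative index in \<open>I'\<close>, and the other indices get 0.\<close>

lemma convex_hull_image_finite:
  fixes f :: "'i \<Rightarrow> 'a::real_vector"
  assumes "finite I" "y \<in> convex hull (f ` I)"
  obtains l where "\<And>i. i \<in> I \<Longrightarrow> 0 \<le> l i" "sum l I = 1" "(\<Sum>i\<in>I. l i *\<^sub>R f i) = y"
proof -
  obtain I' where I': "I' \<subseteq> I" "inj_on f I'" "f ` I = f ` I'"
    using subset_image_inj[of "f ` I" f I] by auto
  obtain u where u: "\<forall>x\<in>f ` I. 0 \<le> u x" "sum u (f ` I) = 1" "(\<Sum>x\<in>f ` I. u x *\<^sub>R x) = y"
    using assms convex_hull_finite[of "f ` I"] by auto
  define l where "l i = (if i \<in> I' then u (f i) else 0)" for i
  show ?thesis
  proof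
    show "0 \<le> l i" if "i \<in> I" for i using that u(1) by (auto simp: l_def)
    have "sum l I = (\<Sum>i\<in>I'. u (f i))"
      using assms(1) I'(1) by (intro sum.mono_neutral_cong_right) (auto simp: l_def)
    also have "\<dots> = 1" using u(2) I' by (simp add: sum.reindex)
    finally show "sum l I = 1" .
    have "(\<Sum>i\<in>I. l i *\<^sub>R f i) = (\<Sum>i\<in>I'. u (f i) *\<^sub>R f i)"
      using assms(1) I'(1) by (intro sum.mono_neutral_cong_right) (auto simp: l_def)
    also have "\<dots> = y" using u(3) I' by (simp add: sum.reindex)
    finally show "(\<Sum>i\<in>I. l i *\<^sub>R f i) = y" .
  qed
qed

lemma exists_inner_nonpos_of_zero_in_convex_hull:
  fixes p :: "'a::real_inner"
  assumes "0 \<in> convex hull C"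
  shows "\<exists>v\<in>C. p \<bullet> v \<le> 0"
proof (rule ccontr)
  assume "\<not> (\<exists>v\<in>C. p \<bullet> v \<le> 0)"
  then have "convex hull C \<subseteq> {v. p \<bullet> v > 0}"
    by (intro hull_minimal) (auto simp: convex_halfspace_gt not_le)
  then show False using assms by auto
qed

text \<open>Among all colorful selections take one whose convex hull is closest to 0. The
  closest point lies on a face spanned by fewer points than there are colors, so a spare
  color can be exchanged to get closer.\<close>
theorem colorful_caratheodory:
  fixes C :: "'i \<Rightarrow> 'a::euclidean_space set"
  assumes I: "finite I" "dim S < card I" and S: "subspace S"
    and C: "\<And>i. i \<in> I \<Longrightarrow> finite (C i)" "\<And>i. i \<in> I \<Longrightarrow> C i \<subseteq> S"
      "\<And>i. i \<in> I \<Longrightarrow> 0 \<in> convex hull (C i)"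
  shows "\<exists>f. (\<forall>i\<in>I. f i \<in> C i) \<and> 0 \<in> convex hull (f ` I)"
proof -
  let ?K = "\<lambda>f. convex hull (f ` I)"
  let ?p = "\<lambda>f. closest_point (?K f) 0"
  have "finite (PiE I C)" using I C by (intro finite_PiE) auto
  moreover have "PiE I C \<noteq> {}" using C(3) by (force simp: PiE_eq_empty_iff)
  ultimately obtain f where f: "f \<in> PiE I C" "\<And>g. g \<in> PiE I C \<Longrightarrow> norm (?p f) \<le> norm (?p g)"
    using arg_min_if_finite[of "PiE I C" "\<lambda>f. norm (?p f)"] that by (meson not_less)
  have cpt: "compact (?K g)" for g :: "'i \<Rightarrow> 'a" using I by (simp add: finite_imp_compact_convex_hull)
  have "I \<noteq> {}" using I by auto
  then have ne: "?K g \<noteq> {}" for g :: "'i \<Rightarrow> 'a" by simp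
  define p where "p = ?p f"
  have pK: "p \<in> ?K f" unfolding p_def by (intro closest_point_in_set compact_imp_closed cpt ne)
  have "p = 0"
  proof (rule ccontr)
    assume "p \<noteq> 0"
    \<comment> \<open>The hull lies beyond the hyperplane through \<open>p\<close> orthogonal to
      \<open>p\<close>, so its part on this hyperplane is a face.\<close>
    have ge: "p \<bullet> p \<le> p \<bullet> x" if "x \<in> ?K f" for x
      using closest_point_dot[of "?K f" x 0] that compact_imp_closed[OF cpt]
      by (simp add: p_def[symmetric] inner_diff_right)
    then have "(?K f \<inter> {x. p \<bullet> x = p \<bullet> p}) face_of ?K f"
      by (intro face_of_Int_supporting_hyperplane_ge) auto
    then obtain F where F: "F \<subseteq> f ` I" "?K f \<inter> {x. p \<bullet> x = p \<bullet> p} = convex hull F"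
      using face_of_convex_hull_subset[of "f ` I"] I(1) finite_imp_compact by blast
    have "f ` I \<subseteq> S" using f(1) C(2) by auto
    moreover have "F \<subseteq> {x. p \<bullet> x = p \<bullet> p}" using F(2) hull_subset[of F convex] by blast
    \<comment> \<open>The hyperplane misses 0, a point of \<open>S\<close>, so it cuts the dimension
      of \<open>S\<close>; Caratheodory then writes \<open>p\<close> with at most
      \<open>dim S\<close> points, fewer than the colors.\<close>
    ultimately have "aff_dim F \<le> aff_dim (S \<inter> {x. p \<bullet> x = p \<bullet> p})"
      using F(1) by (intro aff_dim_subset) auto
    also have "\<dots> < aff_dim S"
      using S subspace_0[OF S] \<open>p \<noteq> 0\<close>
      by (auto simp: aff_dim_affine_Int_hyperplane subspace_imp_affine aff_dim_subspace)
    finally have Fdim: "aff_dim F + 1 \<le> int (dim S)" using S by (simp add: aff_dim_subspace)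
    have "p \<in> convex hull F" using F(2) pK by auto
    then obtain T where T: "finite T" "T \<subseteq> F" "card T \<le> aff_dim F + 1" "p \<in> convex hull T"
      by (auto simp: caratheodory_aff_dim[of F])
    obtain J where J: "J \<subseteq> I" "inj_on f J" "T = f ` J"
      using subset_image_inj[of T f I] T(2) F(1) by auto
    have "card J = card T" using J by (simp add: card_image)
    then have "card J < card I" using T(3) Fdim I(2) by linarith
    then have "J \<noteq> I" by blast
    then obtain i where i: "i \<in> I" "i \<notin> J" using J(1) by blast
    obtain v where v: "v \<in> C i" "p \<bullet> v \<le> 0"
      using exists_inner_nonpos_of_zero_in_convex_hull[OF C(3)[OF i(1)]] by blast
    \<comment> \<open>Recoloring \<open>i\<close> keeps all of \<open>T\<close>, hence
      \<open>p\<close>, in the hull, and moving from \<open>p\<close> towards \<open>v\<close>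
      brings the hull closer to 0.\<close>
    let ?g = "f(i := v)"
    have g: "?g \<in> PiE I C" using f(1) i(1) v(1) by auto
    have "T \<subseteq> ?g ` I" using J i by auto
    then have "p \<in> ?K ?g" using T(4) hull_mono[of T "?g ` I" convex] by blast
    moreover have "v \<in> ?K ?g" using i(1) by (intro hull_inc) auto
    moreover have "(0 - p) \<bullet> (v - p) > 0"
      using v(2) \<open>p \<noteq> 0\<close> by (simp add: inner_diff_right) (metis inner_gt_zero_iff order_le_less_trans)
    then obtain u where u: "u > 0" "u \<le> 1" "dist (p + u *\<^sub>R (v - p)) 0 < dist p 0"
      using closer_point_lemma by blast
    ultimately have "(1 - u) *\<^sub>R p + u *\<^sub>R v \<in> ?K ?g"
      by (intro convexD_alt) auto
    then have "p + u *\<^sub>R (v - p) \<in> ?K ?g" by (simp add: algebra_simps)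
    then have "norm (?p ?g) \<le> norm (p + u *\<^sub>R (v - p))"
      using closest_point_le[OF compact_imp_closed[OF cpt]] by (metis dist_0_norm)
    also have "\<dots> < norm (?p f)" using u(3) by (simp add: p_def)
    finally show False using f(2)[OF g] by simp
  qed
  then show ?thesis using pK f(1) by auto
qed

text \<open>The subspace that holds Sarkaria's lifts is proper; the strict bound ensures more colors
  than dimensions.\<close>

lemma dim_sum_zero_less:
  "dim {v :: 'e::euclidean_space ^ 'r::finite. (\<Sum>a\<in>UNIV. v $ a) = 0} < DIM('e) * CARD('r)"
  (is "dim ?S < _")
proof -
  have S: "subspace ?S"
    by (auto simp: subspace_def sum.distrib scaleR_right.sum[symmetric])
  obtain e :: 'e where "e \<noteq> 0" using nonempty_Basis nonzero_Basis by fastforce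
  then have "axis undefined e \<notin> ?S" by (simp add: axis_def)
  then have "?S \<noteq> UNIV" by blast
  then have "dim ?S < dim (UNIV :: ('e ^ 'r) set)"
    using subspace_dim_equal[OF S subspace_UNIV] by (metis not_less subset_UNIV)
  then show ?thesis by (simp add: mult.commute)
qed

text \<open>Sarkaria's argument: the lifts of a point sum to zero over all blocks, and
  colorful Caratheodory chooses the block of each point.\<close>
lemma tverberg_conic:
  fixes p :: "'i \<Rightarrow> 'e::euclidean_space"
  assumes I: "finite I" "DIM('e) * CARD('r::finite) \<le> card I"
  shows "\<exists>l (s :: 'i \<Rightarrow> 'r) P. (\<forall>i\<in>I. 0 \<le> l i) \<and> sum l I = 1 \<and>
    (\<forall>a. (\<Sum>i\<in>{i\<in>I. s i = a}. l i *\<^sub>R p i) = P)"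
proof -
  \<comment> \<open>\<open>w i a\<close> is \<open>p i\<close> tensored with the \<open>a\<close>-th
    vertex of a simplex centered at 0.\<close>
  define w :: "'i \<Rightarrow> 'r \<Rightarrow> 'e ^ 'r" where
    "w i a = (\<chi> b. (of_bool (a = b) - 1 / real CARD('r)) *\<^sub>R p i)" for i a
  let ?S = "{v :: 'e ^ 'r. (\<Sum>a\<in>UNIV. v $ a) = 0}"
  have wS: "w i a \<in> ?S" for i a
    by (simp add: w_def scaleR_left.sum[symmetric] sum_subtractf)
  have w0: "0 \<in> convex hull (range (w i))" for i
  proof -
    have "(\<Sum>a\<in>UNIV. (1 / real CARD('r)) *\<^sub>R w i a) \<in> convex hull (range (w i))"
      by (intro convex_sum) (auto intro: hull_inc)
    moreover have "(\<Sum>a\<in>UNIV. w i a) = 0"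
      by (simp add: vec_eq_iff w_def scaleR_left.sum[symmetric] sum_subtractf)
    ultimately show ?thesis by (simp add: scaleR_right.sum[symmetric])
  qed
  have "subspace ?S"
    by (auto simp: subspace_def sum.distrib scaleR_right.sum[symmetric])
  then have "\<exists>f. (\<forall>i\<in>I. f i \<in> range (w i)) \<and> 0 \<in> convex hull (f ` I)"
    using I wS w0 order_less_le_trans[OF dim_sum_zero_less I(2)]
    by (intro colorful_caratheodory[of I ?S "\<lambda>i. range (w i)"]) auto
  then obtain f where f: "\<forall>i\<in>I. f i \<in> range (w i)" "0 \<in> convex hull (f ` I)"
    by blast
  have "\<forall>i\<in>I. \<exists>a. f i = w i a" using f(1) by blast
  then obtain s where s: "\<And>i. i \<in> I \<Longrightarrow> f i = w i (s i)" using bchoice by metis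
  obtain l where l: "\<And>i. i \<in> I \<Longrightarrow> 0 \<le> l i" "sum l I = 1" "(\<Sum>i\<in>I. l i *\<^sub>R f i) = 0"
    using convex_hull_image_finite[OF I(1) f(2)] by blast
  \<comment> \<open>Coordinate \<open>a\<close> of the vanishing combination says that the sum over
    block \<open>a\<close> equals the average over all blocks.\<close>
  have "(\<Sum>i\<in>{i\<in>I. s i = a}. l i *\<^sub>R p i) = (1 / real CARD('r)) *\<^sub>R (\<Sum>i\<in>I. l i *\<^sub>R p i)" for a
  proof -
    have "0 = (\<Sum>i\<in>I. l i *\<^sub>R f i) $ a" using l(3) by simp
    also have "\<dots> = (\<Sum>i\<in>I. l i *\<^sub>R (of_bool (s i = a) - 1 / real CARD('r)) *\<^sub>R p i)"
      by (simp add: s w_def)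
    also have "\<dots> = (\<Sum>i\<in>I. of_bool (s i = a) *\<^sub>R l i *\<^sub>R p i) -
        (1 / real CARD('r)) *\<^sub>R (\<Sum>i\<in>I. l i *\<^sub>R p i)"
      by (simp add: algebra_simps sum_subtractf scaleR_right.sum)
    also have "(\<Sum>i\<in>I. of_bool (s i = a) *\<^sub>R l i *\<^sub>R p i) = (\<Sum>i\<in>{i\<in>I. s i = a}. l i *\<^sub>R p i)"
      using I(1) by (intro sum.mono_neutral_cong_right) auto
    finally show ?thesis by simp
  qed
  with l show ?thesis by blast
qed

section \<open>Vector-valued symmetric forms and simultaneous orthogonality\<close>

text \<open>Values in a Euclidean space bundle several scalar forms, so one equation
  \<open>\<beta> x y = 0\<close> is orthogonality for all of them.\<close>

locale symmetric_bilinear = vector_space scale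
  for scale :: "real \<Rightarrow> 'h::ab_group_add \<Rightarrow> 'h" +
  fixes \<beta> :: "'h \<Rightarrow> 'h \<Rightarrow> 'e::euclidean_space"
  assumes commute: "\<beta> x y = \<beta> y x"
    and add_left: "\<beta> (x + y) z = \<beta> x z + \<beta> y z"
    and scale_left: "\<beta> (scale r x) y = r *\<^sub>R \<beta> x y"
begin

lemma zero_left [simp]: "\<beta> 0 y = 0"
  using add_left[of 0 0 y] by simp

lemma zero_right [simp]: "\<beta> x 0 = 0"
  by (simp add: commute[of x])

lemma add_right: "\<beta> x (y + z) = \<beta> x y + \<beta> x z"
  by (simp add: commute[of x] add_left)

lemma scale_right: "\<beta> x (scale r y) = r *\<^sub>R \<beta> x y"
  by (simp add: commute[of x] scale_left)

lemma sum_left: "\<beta> (\<Sum>i\<in>I. f i) y = (\<Sum>i\<in>I. \<beta> (f i) y)"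
  by (induction I rule: infinite_finite_induct) (simp_all add: add_left)

lemma sum_right: "\<beta> x (\<Sum>i\<in>I. f i) = (\<Sum>i\<in>I. \<beta> x (f i))"
  by (simp add: commute[of x] sum_left)

text \<open>Each vector \<open>x i\<close> imposes \<open>DIM('e)\<close> scalar equations on the
  \<open>card J\<close> coefficients of \<open>u\<close>.\<close>

lemma exists_nonzero_orthogonal:
  assumes "finite I" "finite J" "DIM('e) * card I < card J"
    and indep: "\<forall>c. (\<Sum>j\<in>J. scale (c j) (e j)) = 0 \<longrightarrow> (\<forall>j\<in>J. c j = 0)"
  shows "\<exists>u. u \<noteq> 0 \<and> (\<forall>i\<in>I. \<beta> (x i) u = 0)"
proof -
  have "card (I \<times> (Basis :: 'e set)) < card J"
    using assms by (simp add: card_cartesian_product mult.commute)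
  then obtain c where c: "\<exists>j\<in>J. c j \<noteq> 0"
      "\<forall>(i, b)\<in>I \<times> Basis. (\<Sum>j\<in>J. c j * (\<beta> (x i) (e j) \<bullet> b)) = 0"
    using homogeneous_system_nontrivial[of "I \<times> (Basis :: 'e set)" J "\<lambda>(i, b) j. \<beta> (x i) (e j) \<bullet> b"]
      assms(1,2) by auto
  let ?u = "\<Sum>j\<in>J. scale (c j) (e j)"
  have "?u \<noteq> 0" using c(1) indep by blast
  moreover have "\<beta> (x i) ?u = 0" if "i \<in> I" for i
  proof (rule euclidean_eqI)
    fix b :: 'e assume "b \<in> Basis"
    then have "(\<Sum>j\<in>J. c j * (\<beta> (x i) (e j) \<bullet> b)) = 0"
      using bspec[OF c(2), of "(i, b)"] that by simp
    then show "\<beta> (x i) ?u \<bullet> b = 0 \<bullet> b"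
      by (simp only: sum_right scale_right inner_sum_left inner_scaleR_left inner_zero_left)
  qed
  ultimately show ?thesis by blast
qed

text \<open>Greedy choice; the last vector has only \<open>n - 1\<close> predecessors to avoid,
  whence the bound.\<close>

lemma exists_orthogonal_family:
  assumes "finite J" "DIM('e) * (n - 1) < card J"
    and indep: "\<forall>c. (\<Sum>j\<in>J. scale (c j) (e j)) = 0 \<longrightarrow> (\<forall>j\<in>J. c j = 0)"
  shows "\<exists>x. \<forall>i<n. x i \<noteq> 0 \<and> (\<forall>j<n. i \<noteq> j \<longrightarrow> \<beta> (x i) (x j) = 0)"
  using assms(2)
proof (induction n)
  case (Suc n)
  have "DIM('e) * (n - 1) \<le> DIM('e) * n" by (intro mult_left_mono) auto
  also have "\<dots> < card J" using Suc.prems by simp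
  finally obtain x where x: "\<forall>i<n. x i \<noteq> 0 \<and> (\<forall>j<n. i \<noteq> j \<longrightarrow> \<beta> (x i) (x j) = 0)"
    using Suc.IH by blast
  obtain u where u: "u \<noteq> 0" "\<forall>i<n. \<beta> (x i) u = 0"
    using exists_nonzero_orthogonal[of "{..<n}" J e x] assms(1) Suc.prems indep by auto
  show ?case
    using x u by (intro exI[of _ "x(n := u)"]) (auto simp: less_Suc_eq commute[of u])
qed simp

text \<open>Orthogonality makes the form additive on a block, and square roots of the Tverberg
  weights as coefficients give the weighted block sum. The equation for \<open>P\<close> is kept in
  order to show later that its norm component is positive.\<close>

lemma exists_blocks_with_common_value:
  assumes "finite J" "DIM('e) * (DIM('e) * CARD('r) - 1) < card J"
    and indep: "\<forall>c. (\<Sum>j\<in>J. scale (c j) (e j)) = 0 \<longrightarrow> (\<forall>j\<in>J. c j = 0)"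
  shows "\<exists>(I :: nat set) x l P (y :: 'r::finite \<Rightarrow> 'h).
    finite I \<and> (\<forall>i\<in>I. x i \<noteq> 0 \<and> 0 \<le> l i) \<and> sum l I = 1 \<and>
    real CARD('r) *\<^sub>R P = (\<Sum>i\<in>I. l i *\<^sub>R \<beta> (x i) (x i)) \<and>
    (\<forall>a b. \<beta> (y a) (y b) = (if a = b then P else 0))"
proof -
  define n where "n = DIM('e) * CARD('r)"
  obtain x where x: "\<And>i. i < n \<Longrightarrow> x i \<noteq> 0"
      "\<And>i j. i < n \<Longrightarrow> j < n \<Longrightarrow> i \<noteq> j \<Longrightarrow> \<beta> (x i) (x j) = 0"
    using exists_orthogonal_family[of J n e] assms unfolding n_def by blast
  have "DIM('e) * CARD('r) \<le> card {..<n}" by (simp add: n_def)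
  then obtain l P and s :: "nat \<Rightarrow> 'r" where l: "\<forall>i\<in>{..<n}. 0 \<le> l i" "sum l {..<n} = 1"
      "\<forall>a. (\<Sum>i\<in>{i\<in>{..<n}. s i = a}. l i *\<^sub>R \<beta> (x i) (x i)) = P"
    using tverberg_conic[of "{..<n}" "\<lambda>i. \<beta> (x i) (x i)"] by blast
  define B where "B a = {i\<in>{..<n}. s i = a}" for a
  define y where "y a = (\<Sum>i\<in>B a. scale (sqrt (l i)) (x i))" for a
  have "real CARD('r) *\<^sub>R P = (\<Sum>a\<in>UNIV. \<Sum>i\<in>B a. l i *\<^sub>R \<beta> (x i) (x i))"
    using l(3) by (simp add: B_def sum_constant_scaleR)
  also have "\<dots> = (\<Sum>i<n. l i *\<^sub>R \<beta> (x i) (x i))"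
    unfolding B_def by (intro sum.group) auto
  finally have "real CARD('r) *\<^sub>R P = (\<Sum>i<n. l i *\<^sub>R \<beta> (x i) (x i))" .
  moreover have "\<beta> (y a) (y b) = (if a = b then P else 0)" for a b
  proof -
    have "\<beta> (y a) (y b) = (\<Sum>i\<in>B a. \<Sum>j\<in>B b. (sqrt (l i) * sqrt (l j)) *\<^sub>R \<beta> (x i) (x j))"
        by (simp only: y_def sum_left scale_left) (simp add: sum_right scale_right scaleR_right.sum)
    also have "\<dots> = (\<Sum>i\<in>B a. \<Sum>j\<in>B b. if i = j then l i *\<^sub>R \<beta> (x i) (x i) else 0)"
      using x(2) l(1) by (intro sum.cong) (auto simp: B_def)
    also have "\<dots> = (\<Sum>i\<in>B a. if a = b then l i *\<^sub>R \<beta> (x i) (x i) else 0)"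
      by (intro sum.cong) (auto simp: B_def)
    also have "\<dots> = (if a = b then P else 0)" using l(3) by (auto simp: B_def)
    finally show ?thesis .
  qed
  ultimately show ?thesis using x(1) l(1,2)
    by (intro exI[of _ "{..<n}"] exI[of _ x] exI[of _ l] exI[of _ P] exI[of _ y]) simp
qed

end

section \<open>Star-shapedness for real symmetric forms\<close>

text \<open>In \<open>r\<close> this is a quadratic with leading coefficient \<open>t * e\<close>
  and constant term \<open>t - 1\<close>, of opposite signs or zero constant term, so its
  discriminant is nonnegative.\<close>

lemma quadratic_solution:
  fixes s d e t :: real
  assumes "0 < e" "0 < t" "t \<le> 1"
  obtains r where "1 + 2 * r * s = t * (1 + 2 * r * d + r\<^sup>2 * e)"
proof -
  define q where "q = s - t * d"
  define r where "r = (q + sqrt (q\<^sup>2 + t * e * (1 - t))) / (t * e)"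
  have "(t * e * r - q)\<^sup>2 = q\<^sup>2 + t * e * (1 - t)"
    using assms by (simp add: r_def)
  then have "t * e * (t * e * r\<^sup>2 - 2 * q * r) = t * e * (1 - t)"
    by (simp add: power2_eq_square algebra_simps)
  then have "t * e * r\<^sup>2 - 2 * q * r = 1 - t" using assms by simp
  then show ?thesis by (intro that[of r]) (simp add: q_def algebra_simps)
qed

text \<open>With \<open>CARD('m)\<close> blocks, their coefficients and the proportionality factor
  exceed by one the \<open>CARD('m)\<close> equations that make a cross term parallel to a given
  vector.\<close>

theorem starlike_joint_range:
  fixes scale :: "real \<Rightarrow> 'h::ab_group_add \<Rightarrow> 'h"
    and N :: "'h \<Rightarrow> 'h \<Rightarrow> real" and Q :: "'h \<Rightarrow> 'h \<Rightarrow> real ^ 'm::finite"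
  assumes "symmetric_bilinear scale (\<lambda>x y. (N x y, Q x y))"
    and pos: "\<And>x. x \<noteq> 0 \<Longrightarrow> 0 < N x x"
    and J: "finite J" "(CARD('m) + 1) * ((CARD('m) + 1) * CARD('m) - 1) < card J"
    and indep: "\<forall>c. (\<Sum>j\<in>J. scale (c j) (e j)) = 0 \<longrightarrow> (\<forall>j\<in>J. c j = 0)"
  shows "starlike {Q x x | x. N x x = 1}"
proof -
  interpret symmetric_bilinear scale "\<lambda>x y. (N x y, Q x y)" by fact
  have card: "DIM(real \<times> (real ^ 'm)) * (DIM(real \<times> (real ^ 'm)) * CARD('m) - 1) < card J"
    using J(2) by simp
  obtain I x l P and y :: "'m \<Rightarrow> 'h"
    where I: "finite (I :: nat set)" "\<forall>i\<in>I. x i \<noteq> 0 \<and> 0 \<le> l i" "sum l I = 1"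
    and P: "real CARD('m) *\<^sub>R P = (\<Sum>i\<in>I. l i *\<^sub>R (N (x i) (x i), Q (x i) (x i)))"
    and y: "\<forall>a b. (N (y a) (y b), Q (y a) (y b)) = (if a = b then P else 0)"
    using exists_blocks_with_common_value[where 'r = 'm, OF J(1) card indep] by blast
  have "0 < fst P"
  proof -
    obtain i where "i \<in> I" "l i \<noteq> 0" using I(3) by (metis sum.neutral zero_neq_one)
    then have "0 < (\<Sum>i\<in>I. l i * N (x i) (x i))"
      using I pos by (intro sum_pos2[of _ i]) (auto simp: less_le)
    also have "\<dots> = of_nat CARD('m) * fst P"
      using arg_cong[OF P, of fst] by (simp add: fst_sum)
    finally show ?thesis by (simp add: zero_less_mult_iff)
  qed
  \<comment> \<open>All \<open>y a\<close> share the norm \<open>fst P\<close> and the value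
    \<open>snd P\<close>, so this quotient is their value after normalisation.\<close>
  define c where "c = snd P /\<^sub>R fst P"
  interpret N: symmetric_bilinear scale N
    using commute add_left scale_left by unfold_locales auto
  interpret Q: symmetric_bilinear scale Q
    using commute add_left scale_left by unfold_locales auto
  \<comment> \<open>The shift by \<open>c\<close> makes the form vanish on the span of the
    \<open>y a\<close> and measures values as displacements from \<open>c\<close>.\<close>
  define B where "B u v = Q u v - N u v *\<^sub>R c" for u v
  interpret B: symmetric_bilinear scale B
  proof
    show "B u v = B v u" for u v by (simp add: B_def N.commute[of u] Q.commute[of u])
  qed (simp_all add: B_def N.add_left Q.add_left N.scale_left Q.scale_left algebra_simps)
  have Ny: "N (y a) (y b) = (if a = b then fst P else 0)" for a b
    using arg_cong[OF y[rule_format, of a b], of fst] by (auto split: if_splits)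
  have Qy: "Q (y a) (y b) = (if a = b then snd P else 0)" for a b
    using arg_cong[OF y[rule_format, of a b], of snd] by (auto split: if_splits)
  have By: "B (y a) (y b) = 0" for a b
    using \<open>0 < fst P\<close> by (simp add: B_def Ny Qy c_def)
  let ?W = "{Q x x | x. N x x = 1}"
  have normalise: "c + B v v /\<^sub>R N v v \<in> ?W" if "v \<noteq> 0" for v
  proof -
    have v: "0 < N v v" using pos that by simp
    let ?w = "scale (1 / sqrt (N v v)) v"
    have "N ?w ?w = 1" using v by (simp add: N.scale_left N.scale_right)
    moreover have "Q ?w ?w = c + B v v /\<^sub>R N v v"
      using v by (simp add: Q.scale_left Q.scale_right B_def algebra_simps inverse_eq_divide)
    ultimately show ?thesis by (intro CollectI exI[of _ ?w]) simp
  qed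
  have "y undefined \<noteq> 0" using Ny[of undefined undefined] \<open>0 < fst P\<close> by auto
  then have cW: "c \<in> ?W" using normalise[of "y undefined"] By by simp
  have segment: "closed_segment c (Q x x) \<subseteq> ?W" if x: "N x x = 1" for x
  proof
    fix z assume "z \<in> closed_segment c (Q x x)"
    moreover have Qx: "Q x x = c + B x x" using x by (simp add: B_def)
    ultimately obtain t where t: "0 \<le> t" "t \<le> 1" "z = c + t *\<^sub>R B x x"
      by (auto simp: in_segment algebra_simps)
    show "z \<in> ?W"
    proof (cases "t = 0 \<or> B x x = 0")
      case True
      then show ?thesis using t cW by auto
    next
      case False
      \<comment> \<open>A direction \<open>u\<close> in the span of the \<open>y a\<close> with \<open>B x u\<close> parallel to \<open>B x x\<close>; the
        coefficient at \<open>None\<close> is the factor. There is one unknown more than equations.\<close>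
      let ?f = "\<lambda>k a. case a of None \<Rightarrow> - B x x $ k | Some a \<Rightarrow> B x (y a) $ k"
      obtain g where g: "\<exists>a. g a \<noteq> 0" "\<And>k. (\<Sum>a\<in>UNIV. g a * ?f k a) = 0"
        using homogeneous_system_nontrivial[of "UNIV :: 'm set" "UNIV :: 'm option set" ?f]
        by (auto simp: card_UNIV_option)
      define u where "u = (\<Sum>a\<in>UNIV. scale (g (Some a)) (y a))"
      have "(\<Sum>a\<in>UNIV. g (Some a) * B x (y a) $ k) = g None * B x x $ k" for k
        using g(2)[of k] by (simp add: UNIV_option_conv sum.reindex)
      then have Bxu: "B x u = g None *\<^sub>R B x x"
        by (simp add: u_def B.sum_right B.scale_right vec_eq_iff)
      have Buu: "B u u = 0"
        by (simp add: u_def B.sum_right B.scale_right B.sum_left B.scale_left By)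
      \<comment> \<open>A solution supported on \<open>None\<close> would give \<open>u = 0\<close>
        and hence \<open>B x x = 0\<close>.\<close>
      have "\<exists>a. g (Some a) \<noteq> 0"
      proof (rule ccontr)
        assume "\<not> ?thesis"
        then have "g None \<noteq> 0" "u = 0" using g(1) by (auto simp: u_def) (metis not_None_eq)
        then show False using Bxu False by simp
      qed
      then obtain a where "g (Some a) \<noteq> 0" by blast
      moreover have "N (y a) u = g (Some a) * fst P"
        by (simp add: u_def N.sum_right N.scale_right Ny if_distrib cong: if_cong)
      ultimately have "u \<noteq> 0" using \<open>0 < fst P\<close> by auto
      moreover have "0 < t" using t(1) False by simp
      \<comment> \<open>\<open>B v v\<close> stays on the line of \<open>B x x\<close>, as
        \<open>B u u = 0\<close>; this \<open>r\<close> makes its ratio to \<open>N v v\<close>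
        equal to \<open>t\<close> times \<open>B x x\<close>.\<close>
      ultimately obtain r where r: "1 + 2 * r * g None = t * (1 + 2 * r * N x u + r\<^sup>2 * N u u)"
        using quadratic_solution[OF pos _ t(2)] by blast
      define v where "v = x + scale r u"
      have Bv: "B v v = (1 + 2 * r * g None) *\<^sub>R B x x"
        by (simp add: v_def B.add_left B.add_right B.scale_left B.scale_right B.commute[of u x] Bxu Buu
            vec_eq_iff algebra_simps)
      have Nv: "N v v = 1 + 2 * r * N x u + r\<^sup>2 * N u u"
        by (simp add: v_def N.add_left N.add_right N.scale_left N.scale_right N.commute[of u x] x
            power2_eq_square algebra_simps)
      have "v \<noteq> 0"
      proof
        assume "v = 0"
        then have "x = scale (- r) u" by (simp add: v_def eq_neg_iff_add_eq_0)
        then have "B x x = 0" by (simp only: B.scale_left B.scale_right Buu) simp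
        then show False using False by simp
      qed
      moreover have "B v v /\<^sub>R N v v = t *\<^sub>R B x x"
        using pos[OF \<open>v \<noteq> 0\<close>] Bv Nv r by simp
      ultimately show ?thesis using normalise[of v] t(3) by simp
    qed
  qed
  show ?thesis unfolding starlike_def
  proof (intro bexI[OF _ cW] ballI)
    fix a assume "a \<in> ?W"
    then show "closed_segment c a \<subseteq> ?W" using segment by auto
  qed
qed

section \<open>From the complex Hilbert space to real forms\<close>

lemma real_symmetric_bilinear_of_operators:
  fixes sc :: "complex \<Rightarrow> 'h::ab_group_add \<Rightarrow> 'h" and A :: "'m::finite \<Rightarrow> 'h \<Rightarrow> 'h"
  assumes H: "complex_hilbert_space sc ip" and A: "\<And>k. bounded_selfadjoint sc ip (A k)"
  shows "symmetric_bilinear (\<lambda>r. sc (complex_of_real r))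
    (\<lambda>x y. (Re (ip x y), \<chi> k. Re (ip (A k x) y)))"
proof -
  interpret V: vector_space sc using H by (simp add: complex_hilbert_space_def)
  have cnj: "\<forall>x y. ip x y = cnj (ip y x)"
    and add: "\<forall>x y z. ip (x + y) z = ip x z + ip y z"
    and scale: "\<forall>c x y. ip (sc c x) y = c * ip x y"
    using H unfolding complex_hilbert_space_def by - (elim conjE, assumption)+
  have selfadjoint: "ip (A k x) y = ip x (A k y)" for k x y
    using A[of k] unfolding bounded_selfadjoint_def by (elim conjE) simp
  have "Vector_Spaces.linear sc sc (A k)" for k
    using A[of k] unfolding bounded_selfadjoint_def by (elim conjE)
  then have A_linear: "module_hom sc sc (A k)" for k
    by (simp add: linear_iff_module_hom)
  show ?thesis
  proof
    fix x y z r
    have "Re (ip (A k x) y) = Re (ip (A k y) x)" for k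
      using selfadjoint[of k x y] cnj[rule_format, of x "A k y"] by simp
    moreover have "Re (ip x y) = Re (ip y x)"
      using cnj[rule_format, of x y] by simp
    ultimately show "(Re (ip x y), \<chi> k. Re (ip (A k x) y)) = (Re (ip y x), \<chi> k. Re (ip (A k y) x))"
      by (simp only:)
    show "(Re (ip (x + y) z), \<chi> k. Re (ip (A k (x + y)) z)) =
      (Re (ip x z), \<chi> k. Re (ip (A k x) z)) + (Re (ip y z), \<chi> k. Re (ip (A k y) z))"
      using add by (simp add: vec_eq_iff module_hom.add[OF A_linear])
    show "(Re (ip (sc (complex_of_real r) x) y), \<chi> k. Re (ip (A k (sc (complex_of_real r) x)) y)) =
      r *\<^sub>R (Re (ip x y), \<chi> k. Re (ip (A k x) y))"
      using scale by (simp add: vec_eq_iff module_hom.scale[OF A_linear])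
  qed (simp_all add: V.scale_right_distrib V.scale_left_distrib)
qed

text \<open>The real coefficients of \<open>b\<close> and \<open>\<i> b\<close> combine into one
  complex coefficient of \<open>b\<close>; thus a complex basis counts twice over the reals.\<close>

lemma real_independent_of_complex_independent:
  assumes "vector_space sc" "finite B" "module.independent sc B"
    and zero: "(\<Sum>(b, i)\<in>B \<times> (UNIV :: bool set).
      sc (complex_of_real (c (b, i))) (sc (if i then \<i> else 1) b)) = 0"
  shows "\<forall>j\<in>B \<times> UNIV. c j = 0"
proof -
  interpret vector_space sc by fact
  have "(\<Sum>b\<in>B. sc (Complex (c (b, False)) (c (b, True))) b) = 0"
    using zero
    by (simp add: sum.cartesian_product[symmetric] UNIV_bool scale_left_distrib[symmetric]
        Complex_eq mult.commute)
  then have "Complex (c (b, False)) (c (b, True)) = 0" if "b \<in> B" for b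
    using independentD[OF assms(3,2) subset_refl _ that,
        where u = "\<lambda>b. Complex (c (b, False)) (c (b, True))"] by simp
  then have "c (b, i) = 0" if "b \<in> B" for b i
    using that by (cases i) (simp_all add: complex_eq_iff)
  then show ?thesis by auto
qed

theorem theorem3p7:
  fixes sc :: "complex \<Rightarrow> 'h::ab_group_add \<Rightarrow> 'h"
    and ip :: "'h \<Rightarrow> 'h \<Rightarrow> complex"
    and A :: "'m::finite \<Rightarrow> 'h \<Rightarrow> 'h"
  assumes "complex_hilbert_space sc ip"
    and "\<And>k. bounded_selfadjoint sc ip (A k)"
    and "dim_at_least sc
           (nat \<lfloor>(real CARD('m) + 1) / 2\<rfloor> * (CARD('m) + 1) ^ 2)"
  shows "starlike (joint_numerical_range ip A)"
proof -
  define m where "m = CARD('m)"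
  have "0 < m" by (simp add: m_def)
  have half: "nat \<lfloor>(real m + 1) / 2\<rfloor> = (m + 1) div 2"
    using floor_divide_of_nat_eq[of "m + 1" 2, where 'a = real]
    by (metis nat_int of_nat_1 of_nat_add of_nat_numeral)
  obtain B where B: "finite B" "card B = (m + 1) div 2 * (m + 1)\<^sup>2" "module.independent sc B"
    using assms(3) half unfolding dim_at_least_def m_def by metis
  have "vector_space sc" and cnj: "\<forall>x y. ip x y = cnj (ip y x)"
    and pos: "\<forall>x. Re (ip x x) \<ge> 0" "\<forall>x. ip x x = 0 \<longrightarrow> x = 0"
    using assms(1) unfolding complex_hilbert_space_def by - (elim conjE, assumption)+
  \<comment> \<open>Doubling the dimension absorbs the rounding in \<open>(m + 1) div 2\<close>: at
    least \<open>m * (m + 1)^2\<close> real dimensions are available, strictly above the bound of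
    the real theorem.\<close>
  have "m \<le> 2 * ((m + 1) div 2)" by simp
  then have "m * (m + 1)\<^sup>2 \<le> 2 * card B" unfolding B(2) mult.assoc[symmetric] by (rule mult_right_mono) simp
  moreover have "(m + 1) * ((m + 1) * m - 1) < (m + 1) * ((m + 1) * m)"
    using \<open>0 < m\<close> by (intro mult_strict_left_mono) auto
  moreover have "(m + 1) * ((m + 1) * m) = m * (m + 1)\<^sup>2"
    by (simp add: power2_eq_square algebra_simps)
  moreover have "card (B \<times> (UNIV :: bool set)) = 2 * card B"
    by (simp add: card_cartesian_product)
  ultimately have card: "(m + 1) * ((m + 1) * m - 1) < card (B \<times> (UNIV :: bool set))"
    by linarith
  have "Im (ip x x) = 0" for x
    using arg_cong[OF cnj[rule_format, of x x], of Im] by simp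
  then have pos': "0 < Re (ip x x)" if "x \<noteq> 0" for x
    using pos(1)[rule_format, of x] pos(2)[rule_format, of x] that
    by (auto simp: less_le complex_eq_iff)
  let ?e = "\<lambda>(b, i). sc (if i then \<i> else 1) b"
  have "\<forall>c. (\<Sum>j\<in>B \<times> UNIV. sc (complex_of_real (c j)) (?e j)) = 0 \<longrightarrow> (\<forall>j\<in>B \<times> UNIV. c j = 0)"
    using real_independent_of_complex_independent[OF \<open>vector_space sc\<close> B(1,3)]
    by (simp add: case_prod_unfold)
  then have "starlike {(\<chi> k. Re (ip (A k x) x)) | x. Re (ip x x) = 1}"
    using card
    by (intro starlike_joint_range[OF real_symmetric_bilinear_of_operators[OF assms(1,2)] pos',
          where J = "B \<times> (UNIV :: bool set)" and e = ?e]) (simp_all add: B(1) m_def)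
  then show ?thesis by (simp add: joint_numerical_range_def hnorm_def)
qed

end
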